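(* Let $n$ be a positive integer, let $\ell\ge 3$ be an integer, and let $T$ be a subset of $\mathbb{Z}_n$. If there exists a $|T|\times\ell$ matrix $A=[a_{ij}]$ with entries from $T$ such that (1) each row of $A$ sums to $0$ in $\mathbb{Z}_n$, and (2) each column of $A$ is a permutation of $T$, then there exists a $C_\ell$-factorization of $C_\ell[T]$. Moreover, if in addition (3) $T$ is closed under taking negatives, then there is a $C_m$-factorization of $C_m[T]$ for every integer $m\geq\ell$ with $m\equiv\ell\pmod 2$.
   Context: For an integer $k\ge3$ and $S\subseteq\mathbb{Z}_n$, $C_k[S]$ is the graph with vertex set $\mathbb{Z}_k\times\mathbb{Z}_n$ (vertex $(i,x)$ written $i_x$) and edges $i_x(i+1)_{x+d}$ for all $i\in\mathbb{Z}_k$, $x\in\mathbb{Z}_n$, $d\in S$. A $C_k$-factor of a graph $G$ is a spanning subgraph all of whose components are $k$-cycles; a $C_k$-factorization of $G$ is a partition of its edge set into $C_k$-factors. *)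

theory Defs
  imports Jordan_Normal_Form.Matrix "HOL-Library.Disjoint_Sets" "HOL-Number_Theory.Cong"
begin

datatype 'a graph = Graph (verts: "'a set") (edges: "'a set set")

definition simple_graph :: "'a graph \<Rightarrow> bool" where
  "simple_graph G \<longleftrightarrow> (\<forall>e\<in>edges G. e \<subseteq> verts G \<and> card e = 2)"

definition spanning_subgraph :: "'a graph \<Rightarrow> 'a graph \<Rightarrow> bool" where
  "spanning_subgraph H G \<longleftrightarrow>
     simple_graph H \<and> verts H = verts G \<and> edges H \<subseteq> edges G"

definition induced_subgraph :: "'a graph \<Rightarrow> 'a set \<Rightarrow> 'a graph" where
  "induced_subgraph G W = Graph W {e \<in> edges G. e \<subseteq> W}"

definition joined :: "'a graph \<Rightarrow> 'a rel" where
  "joined G = {(u, v). {u, v} \<in> edges G}\<^sup>* \<inter> verts G \<times> verts G"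

definition components :: "'a graph \<Rightarrow> 'a graph set" where
  "components G = induced_subgraph G ` (verts G // joined G)"

definition is_cycle :: "nat \<Rightarrow> 'a graph \<Rightarrow> bool" where
  "is_cycle k G \<longleftrightarrow> k \<ge> 3 \<and>
     (\<exists>v. inj_on v {..<k} \<and> verts G = v ` {..<k} \<and>
          edges G = {{v i, v (Suc i mod k)} | i. i < k})"

definition cycle_factor :: "nat \<Rightarrow> 'a graph \<Rightarrow> 'a graph \<Rightarrow> bool" where
  "cycle_factor k G F \<longleftrightarrow> spanning_subgraph F G \<and> (\<forall>C\<in>components F. is_cycle k C)"

text \<open>A spanning subgraph is determined by its edge set, so a factorization of \<open>G\<close> is
  represented by the partition of the edges of \<open>G\<close> into the edge sets of the factors.\<close>

definition cycle_factorization :: "nat \<Rightarrow> 'a graph \<Rightarrow> 'a set set set \<Rightarrow> bool" where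
  "cycle_factorization k G P \<longleftrightarrow>
     partition_on (edges G) P \<and> (\<forall>F\<in>P. cycle_factor k G (Graph (verts G) F))"

text \<open>The elements of the integers modulo \<open>n\<close> are represented by their least nonnegative
  residues; arithmetic on them is carried out with \<open>mod\<close>.\<close>

definition Zmod :: "nat \<Rightarrow> int set" where
  "Zmod n = {0..<int n}"

text \<open>\<open>cycle_blowup k n S\<close> is the graph \<open>C\<^sub>k[S]\<close> for a subset \<open>S\<close> of \<open>Zmod n\<close>; the vertex
  \<open>i\<^sub>x\<close> is the pair \<open>(i, x)\<close>.\<close>

definition cycle_blowup :: "nat \<Rightarrow> nat \<Rightarrow> int set \<Rightarrow> (int \<times> int) graph" where
  "cycle_blowup k n S = Graph (Zmod k \<times> Zmod n)
     {{(i, x), ((i + 1) mod int k, (x + d) mod int n)} | i x d.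
        i \<in> Zmod k \<and> x \<in> Zmod n \<and> d \<in> S}"

lemma simple_graph_cycle_blowup:
  assumes "k \<ge> 3" "n > 0"
  shows "simple_graph (cycle_blowup k n S)"
proof -
  have "(i + 1) mod int k \<noteq> i" if "i \<in> Zmod k" for i
  proof
    assume h: "(i + 1) mod int k = i"
    show False
    proof (cases "i + 1 = int k")
      case True
      with h assms show False by simp
    next
      case False
      with that have "(i + 1) mod int k = i + 1" by (simp add: Zmod_def)
      with h show False by simp
    qed
  qed
  then show ?thesis
    using assms unfolding simple_graph_def cycle_blowup_def
    by (auto simp: Zmod_def card_2_iff) (metis prod.inject)
qed

end

theory Submission
  imports Defs
begin

text \<open>Row \<open>r\<close> of the matrix gives the factor whose edges from layer \<open>j\<close> to layer \<open>j + 1\<close> all have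
  difference \<open>a r j\<close>. As the row sums to zero, each walk around the layers closes up after one
  round, so this factor is a union of vertex-disjoint cycles. As the columns are permutations of
  \<open>T\<close>, every edge lies in exactly one factor. If \<open>T\<close> is closed under negation, two further columns
  \<open>c\<close> and \<open>- c\<close>, where \<open>c\<close> is a column of the matrix, preserve both properties.\<close>

section \<open>Components of a union of disjoint cycles\<close>

text \<open>Injectivity in both arguments makes the cycles \<open>v x\<close> vertex-disjoint, so no
  edge leaves the vertex set of one of them. As each is connected, they are the components.\<close>

lemma is_cycle_component:
  fixes v :: "'b \<Rightarrow> nat \<Rightarrow> 'a"
  assumes k: "k \<ge> 3"
    and inj: "inj_on (\<lambda>(x, i). v x i) (X \<times> {..<k})"
    and V: "verts G = (\<lambda>(x, i). v x i) ` (X \<times> {..<k})"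
    and E: "edges G = {{v x i, v x (Suc i mod k)} | x i. x \<in> X \<and> i < k}"
    and C: "C \<in> components G"
  shows "is_cycle k C"
proof -
  have v_eq: "x = y \<and> i = j" if "v x i = v y j" "x \<in> X" "y \<in> X" "i < k" "j < k" for x y i j
    using inj_onD[OF inj, of "(x, i)" "(y, j)"] that by auto
  have lt: "Suc i mod k < k" for i
    using k by simp
  obtain u where u: "u \<in> verts G" and C_eq: "C = induced_subgraph G (joined G `` {u})"
    using C unfolding components_def quotient_def by auto
  obtain x i0 where x: "x \<in> X" "i0 < k" "u = v x i0"
    using u unfolding V by auto
  let ?R = "{(u, v). {u, v} \<in> edges G}"
  let ?W = "v x ` {..<k}"
  have step: "b \<in> ?W" if a: "a \<in> ?W" and ab: "(a, b) \<in> ?R" for a b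
  proof -
    obtain y i where y: "y \<in> X" "i < k" "{a, b} = {v y i, v y (Suc i mod k)}"
      using ab unfolding E by auto
    obtain j where j: "j < k" "a = v x j"
      using a by auto
    have "a = v y i \<or> a = v y (Suc i mod k)"
      using y(3) by blast
    then have "x = y"
      using v_eq j x(1) y(1,2) lt by metis
    moreover have "b = v y i \<or> b = v y (Suc i mod k)"
      using y(3) by blast
    ultimately show ?thesis
      using y(2) lt by blast
  qed
  have reach_W: "b \<in> ?W" if "(u, b) \<in> ?R\<^sup>*" for b
    using that by induction (use x step in auto)
  \<comment> \<open>The path climbs from index \<open>0\<close> to \<open>i < k\<close>, so
    \<open>mod\<close> never wraps around on it.\<close>
  have from_0: "(v x 0, v x i) \<in> ?R\<^sup>*" if "i < k" for i
    using that
  proof (induction i)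
    case (Suc i)
    have "{v x i, v x (Suc i)} \<in> edges G"
      unfolding E using Suc.prems x(1) by (force intro!: exI[of _ x] exI[of _ i])
    then have "(v x i, v x (Suc i)) \<in> ?R"
      by simp
    with Suc show ?case
      by (meson Suc_lessD rtrancl.rtrancl_into_rtrancl)
  qed simp
  \<comment> \<open>Reversing the path from \<open>v x 0\<close> to \<open>u\<close> moves its
    starting point to \<open>u\<close>.\<close>
  have "sym ?R"
    by (auto simp: sym_def insert_commute)
  then have "(u, v x 0) \<in> ?R\<^sup>*"
    using from_0[OF x(2)] x(3) by (metis sym_rtrancl symE)
  then have "(u, v x i) \<in> ?R\<^sup>*" if "i < k" for i
    using from_0[OF that] by (rule rtrancl_trans)
  then have W: "joined G `` {u} = ?W"
    using reach_W u x(1) unfolding joined_def V by auto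
  \<comment> \<open>An edge inside \<open>?W\<close> has an endpoint \<open>v y i\<close> there,
    which forces \<open>y = x\<close>; the induced subgraph thus has only the edges of the
    cycle.\<close>
  have "{e \<in> edges G. e \<subseteq> ?W} = {{v x i, v x (Suc i mod k)} | i. i < k}"
  proof (intro equalityI subsetI)
    fix e assume "e \<in> {e \<in> edges G. e \<subseteq> ?W}"
    then obtain y i j where y: "y \<in> X" "i < k" "e = {v y i, v y (Suc i mod k)}"
      and j: "j < k" "v y i = v x j"
      unfolding E by auto
    have "y = x"
      using v_eq[OF j(2)] y x(1) j(1) by blast
    with y show "e \<in> {{v x i, v x (Suc i mod k)} | i. i < k}"
      by blast
  next
    fix e assume "e \<in> {{v x i, v x (Suc i mod k)} | i. i < k}"
    then show "e \<in> {e \<in> edges G. e \<subseteq> ?W}"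
      using x(1) lt unfolding E by blast
  qed
  moreover have "inj_on (v x) {..<k}"
    using v_eq x(1) by (auto intro!: inj_onI)
  ultimately show ?thesis
    unfolding is_cycle_def C_eq W induced_subgraph_def using k
    by (intro conjI exI[of _ "v x"]) auto
qed

section \<open>Edges of the blow-up, sorted by layer and difference\<close>

text \<open>The layer is a natural number so that it can also serve as a column index.\<close>

definition layer_edge :: "nat \<Rightarrow> nat \<Rightarrow> nat \<Rightarrow> int \<Rightarrow> int \<Rightarrow> (int \<times> int) set" where
  "layer_edge k n j x d = {(int j, x), (int (Suc j mod k), (x + d) mod int n)}"

lemma verts_cycle_blowup: "verts (cycle_blowup k n S) = Zmod k \<times> Zmod n"
  by (simp add: cycle_blowup_def)

lemma edges_cycle_blowup:
  "edges (cycle_blowup k n S) = {layer_edge k n j x d | j x d. j < k \<and> x \<in> Zmod n \<and> d \<in> S}"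
proof -
  have "Zmod k = int ` {..<k}"
    by (simp add: Zmod_def lessThan_atLeast0 image_int_atLeastLessThan)
  moreover have "(int j + 1) mod int k = int (Suc j mod k)" for j
    by (simp add: zmod_int add.commute)
  ultimately show ?thesis
    unfolding cycle_blowup_def layer_edge_def by (fastforce simp: image_iff)
qed

text \<open>This separates the factors of different rows: a shared edge reveals its column and the
  entry that the rows have there.\<close>

lemma layer_edge_eqD:
  assumes "k \<ge> 3" "j < k" "j' < k" "d \<in> Zmod n" "d' \<in> Zmod n"
    and eq: "layer_edge k n j x d = layer_edge k n j' x' d'"
  shows "j = j' \<and> x = x' \<and> d = d'"
proof -
  \<comment> \<open>Edges are unordered, so endpoints could match crosswise. Then \<open>j\<close>
    and \<open>j'\<close> would each follow the other modulo \<open>k\<close>, impossible for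
    \<open>k \<ge> 3\<close>.\<close>
  have "\<not> (j = Suc j' mod k \<and> Suc j mod k = j')"
    using assms(1-3) by (auto simp: mod_Suc split: if_splits)
  then have *: "j = j'" "x = x'" "(x + d) mod int n = (x + d') mod int n"
    using eq unfolding layer_edge_def doubleton_eq_iff by auto
  from *(3) have "(x + d - x) mod int n = (x + d' - x) mod int n"
    by (rule mod_diff_cong) simp
  then have "d = d'"
    using assms(4,5) by (simp add: Zmod_def)
  with * show ?thesis by simp
qed

section \<open>From rows to factors\<close>

lemma cycle_factor_row:
  fixes c :: "nat \<Rightarrow> int"
  assumes n: "n > 0" and k: "k \<ge> 3"
    and c: "\<And>j. j < k \<Longrightarrow> c j \<in> S"
    and sum: "[(\<Sum>j<k. c j) = 0] (mod int n)"
  shows "cycle_factor k (cycle_blowup k n S)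
    (Graph (verts (cycle_blowup k n S)) {layer_edge k n j x (c j) | j x. j < k \<and> x \<in> Zmod n})"
    (is "cycle_factor k ?B ?F")
proof -
  \<comment> \<open>The walk that starts at \<open>x\<close> in layer \<open>0\<close> and moves by
    \<open>c t\<close> in layer \<open>t\<close> is at \<open>v x j\<close> on reaching layer
    \<open>j\<close>.\<close>
  define s where "s j = (\<Sum>t<j. c t)" for j
  define v where "v x j = (int j, (x + s j) mod int n)" for x j
  have Zmod_mod: "y mod int n \<in> Zmod n" for y
    using n by (simp add: Zmod_def)
  have mod_Zmod: "y mod int n = y" if "y \<in> Zmod n" for y
    using that by (simp add: Zmod_def)
  \<comment> \<open>Translation by \<open>s j\<close> permutes the residues, so the walks visit each
    vertex of a layer exactly once.\<close>
  have surj: "\<exists>x\<in>Zmod n. (x + s j) mod int n = y" if "y \<in> Zmod n" for j y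
  proof
    show "((y - s j) mod int n + s j) mod int n = y"
      using mod_Zmod[OF that] by (simp add: mod_add_left_eq)
  qed (rule Zmod_mod)
  have shift_eqD: "x = y" if "(x + s j) mod int n = (y + s j) mod int n" "x \<in> Zmod n" "y \<in> Zmod n" for x y j
  proof -
    have "(x + s j - s j) mod int n = (y + s j - s j) mod int n"
      using that(1) by (rule mod_diff_cong) simp
    then show ?thesis
      using mod_Zmod that by simp
  qed
  have inj: "inj_on (\<lambda>(x, i). v x i) (Zmod n \<times> {..<k})"
    by (auto simp: v_def intro!: inj_onI intro: shift_eqD)
  have verts: "verts ?F = (\<lambda>(x, i). v x i) ` (Zmod n \<times> {..<k})"
  proof (intro equalityI subsetI)
    fix p assume "p \<in> verts ?F"
    then obtain i y where p: "p = (i, y)" "i \<in> Zmod k" "y \<in> Zmod n"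
      by (auto simp: verts_cycle_blowup)
    obtain x where "x \<in> Zmod n" "(x + s (nat i)) mod int n = y"
      using surj p(3) by blast
    then show "p \<in> (\<lambda>(x, i). v x i) ` (Zmod n \<times> {..<k})"
      using p by (auto simp: v_def Zmod_def image_iff intro!: bexI[of _ x] bexI[of _ "nat i"])
  qed (auto simp: verts_cycle_blowup v_def Zmod_def n)
  have edge: "layer_edge k n j ((x + s j) mod int n) (c j) = {v x j, v x (Suc j mod k)}"
    if "j < k" for j x
  proof -
    have "(x + s (Suc j)) mod int n = (x + s (Suc j mod k)) mod int n"
    \<comment> \<open>In the last layer the index wraps to \<open>0\<close>, where
      \<open>s 0 = 0\<close>. The zero row sum makes \<open>s k\<close> congruent to this, which
      closes the walk.\<close>
    proof (cases "Suc j = k")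
      case True
      have "[x + s k = x + 0] (mod int n)"
        using sum unfolding s_def by (intro cong_add) simp_all
      with True show ?thesis
        by (simp add: cong_def s_def)
    qed (use that in simp)
    then show ?thesis
      by (simp add: layer_edge_def v_def mod_simps s_def add.assoc)
  qed
  have edges: "edges ?F = {{v x i, v x (Suc i mod k)} | x i. x \<in> Zmod n \<and> i < k}"
  proof (intro equalityI subsetI)
    fix e assume "e \<in> edges ?F"
    then obtain j y where e: "e = layer_edge k n j y (c j)" "j < k" "y \<in> Zmod n"
      by auto
    obtain x where "x \<in> Zmod n" "(x + s j) mod int n = y"
      using surj e(3) by blast
    with e edge[of j x] show "e \<in> {{v x i, v x (Suc i mod k)} | x i. x \<in> Zmod n \<and> i < k}"
      by blast
  next
    fix e assume "e \<in> {{v x i, v x (Suc i mod k)} | x i. x \<in> Zmod n \<and> i < k}"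
    then obtain x i where "e = {v x i, v x (Suc i mod k)}" "i < k"
      by blast
    then have "e = layer_edge k n i ((x + s i) mod int n) (c i)"
      using edge by simp
    with \<open>i < k\<close> Zmod_mod show "e \<in> edges ?F"
      by auto
  qed
  have "edges ?F \<subseteq> edges ?B"
    using c unfolding edges_cycle_blowup by auto
  then have "spanning_subgraph ?F ?B"
    using simple_graph_cycle_blowup[OF k n, of S]
    by (auto simp: spanning_subgraph_def simple_graph_def)
  then show ?thesis
    using is_cycle_component[OF k inj verts edges] by (simp add: cycle_factor_def)
qed

section \<open>From matrices to factorizations\<close>

text \<open>Surjectivity of column \<open>j\<close> puts each edge leaving layer \<open>j\<close>
  into the factor of some row; injectivity allows only one such row.\<close>

lemma cycle_factorization_of_rows:
  fixes a :: "'r \<Rightarrow> nat \<Rightarrow> int"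
  assumes n: "n > 0" and k: "k \<ge> 3" and S: "S \<subseteq> Zmod n"
    and sum: "\<And>r. r \<in> R \<Longrightarrow> [(\<Sum>j<k. a r j) = 0] (mod int n)"
    and bij: "\<And>j. j < k \<Longrightarrow> bij_betw (\<lambda>r. a r j) R S"
  shows "\<exists>P. cycle_factorization k (cycle_blowup k n S) P"
proof -
  define F where "F r = {layer_edge k n j x (a r j) | j x. j < k \<and> x \<in> Zmod n}" for r
  have a: "a r j \<in> S" if "r \<in> R" "j < k" for r j
    using bij[OF that(2)] that(1) by (auto simp: bij_betw_def)
  have "\<Union> (F ` R) = edges (cycle_blowup k n S)"
  proof (intro equalityI subsetI)
    fix e assume "e \<in> edges (cycle_blowup k n S)"
    then obtain j x d where e: "e = layer_edge k n j x d" "j < k" "x \<in> Zmod n" "d \<in> S"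
      unfolding edges_cycle_blowup by blast
    obtain r where "r \<in> R" "a r j = d"
      using bij[OF e(2)] e(4) by (auto simp: bij_betw_def)
    with e show "e \<in> \<Union> (F ` R)"
      unfolding F_def by blast
  next
    fix e assume "e \<in> \<Union> (F ` R)"
    then show "e \<in> edges (cycle_blowup k n S)"
      using a unfolding F_def edges_cycle_blowup by blast
  qed
  moreover have "F r \<inter> F r' = {}" if rr: "r \<in> R" "r' \<in> R" "F r \<noteq> F r'" for r r'
  proof (rule ccontr)
    assume "F r \<inter> F r' \<noteq> {}"
    then obtain j x j' x' where j: "j < k" "j' < k"
      and eq: "layer_edge k n j x (a r j) = layer_edge k n j' x' (a r' j')"
      unfolding F_def by blast
    have "j = j'" "a r j = a r' j'"
      using layer_edge_eqD[OF k j _ _ eq] a rr j S by blast+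
    then have "r = r'"
      using bij[OF j(1)] rr by (auto simp: bij_betw_def inj_on_def)
    with rr show False by simp
  qed
  \<comment> \<open>Since \<open>n\<close> and \<open>k\<close> are positive, there is an edge
    leaving the vertex \<open>0\<close> of layer \<open>0\<close>.\<close>
  moreover have "{} \<noteq> F r" for r
    unfolding F_def using n k by (force simp: Zmod_def)
  ultimately have "partition_on (edges (cycle_blowup k n S)) (F ` R)"
    by (intro partition_onI) (blast, auto simp: disjnt_def)
  moreover have "cycle_factor k (cycle_blowup k n S) (Graph (verts (cycle_blowup k n S)) (F r))"
    if "r \<in> R" for r
    unfolding F_def using a sum that by (intro cycle_factor_row[OF n k]) auto
  ultimately show ?thesis
    unfolding cycle_factorization_def by blast
qed

section \<open>Appending pairs of columns\<close>

lemma extend_rows: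
  fixes a :: "'r \<Rightarrow> nat \<Rightarrow> int"
  assumes S: "S \<subseteq> Zmod n" and neg: "\<forall>t\<in>S. (- t) mod int n \<in> S" and k: "k > 0"
    and sum: "\<And>r. r \<in> R \<Longrightarrow> [(\<Sum>j<k. a r j) = 0] (mod int n)"
    and bij: "\<And>j. j < k \<Longrightarrow> bij_betw (\<lambda>r. a r j) R S"
  shows "\<exists>b :: 'r \<Rightarrow> nat \<Rightarrow> int. (\<forall>r\<in>R. [(\<Sum>j<k + 2 * q. b r j) = 0] (mod int n)) \<and>
           (\<forall>j<k + 2 * q. bij_betw (\<lambda>r. b r j) R S)"
proof -
  have neg_neg: "(- ((- t) mod int n)) mod int n = t" if "t \<in> S" for t
    using that S by (auto simp: mod_simps Zmod_def)
  \<comment> \<open>Negation is an involution on \<open>S\<close>, hence its own inverse.\<close>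
  have neg_bij: "bij_betw (\<lambda>t. (- t) mod int n) S S"
    using neg neg_neg by (intro bij_betw_byWitness[where f' = "\<lambda>t. (- t) mod int n"]) auto
  \<comment> \<open>From column \<open>k\<close> on, column \<open>0\<close> and its negative
    alternate; \<open>k > 0\<close> ensures that column \<open>0\<close> is one of the given
    ones.\<close>
  define b where
    "b r j = (if j < k then a r j else if even (j - k) then a r 0 else (- a r 0) mod int n)" for r j
  have "[(\<Sum>j<k + 2 * q. b r j) = 0] (mod int n)" if "r \<in> R" for r
  proof (induction q)
    case 0
    then show ?case
      using sum[OF that] by (simp add: b_def)
  next
    case (Suc q)
    \<comment> \<open>This is the contribution of the new columns \<open>k + 2 * q\<close> and
      \<open>k + 2 * q + 1\<close>.\<close>
    have "[a r 0 + (- a r 0) mod int n = 0] (mod int n)"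
      by (simp add: cong_def mod_simps)
    from cong_add[OF Suc this] show ?case
      by (simp add: b_def add.assoc)
  qed
  moreover have "bij_betw (\<lambda>r. b r j) R S" for j
    using bij[of j] bij[OF k] bij_betw_trans[OF bij[OF k] neg_bij]
    by (cases "j < k"; cases "even (j - k)") (simp_all add: b_def comp_def)
  ultimately show ?thesis
    by blast
qed

theorem theorem2p9:
  fixes n l :: nat and T :: "int set"
  assumes "n > 0" and "l \<ge> 3" and "T \<subseteq> Zmod n"
    and "\<exists>A :: int mat. A \<in> carrier_mat (card T) l \<and>
           (\<forall>i<card T. \<forall>j<l. A $$ (i, j) \<in> T) \<and>
           (\<forall>i<card T. [(\<Sum>j<l. A $$ (i, j)) = 0] (mod int n)) \<and>
           (\<forall>j<l. bij_betw (\<lambda>i. A $$ (i, j)) {..<card T} T)"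
  shows "(\<exists>P. cycle_factorization l (cycle_blowup l n T) P) \<and>
         ((\<forall>t\<in>T. (- t) mod int n \<in> T) \<longrightarrow>
            (\<forall>m\<ge>l. [m = l] (mod 2) \<longrightarrow>
               (\<exists>P. cycle_factorization m (cycle_blowup m n T) P)))"
proof -
  obtain A :: "int mat"
    where sum: "\<And>i. i \<in> {..<card T} \<Longrightarrow> [(\<Sum>j<l. A $$ (i, j)) = 0] (mod int n)"
      and bij: "\<And>j. j < l \<Longrightarrow> bij_betw (\<lambda>i. A $$ (i, j)) {..<card T} T"
    using assms(4) by auto
  show ?thesis
  proof (intro conjI impI allI)
    show "\<exists>P. cycle_factorization l (cycle_blowup l n T) P"
      using cycle_factorization_of_rows[OF assms(1-3) sum bij] .
  next
    fix m assume neg: "\<forall>t\<in>T. (- t) mod int n \<in> T" and m: "m \<ge> l" "[m = l] (mod 2)"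
    \<comment> \<open>Equal parity lets the \<open>m - l\<close> missing columns be supplied as
      \<open>q\<close> pairs.\<close>
    have "2 dvd m - l"
      using m by (simp add: cong_altdef_nat)
    then obtain q where q: "m = l + 2 * q"
      using m(1) by (metis dvdE le_add_diff_inverse)
    have "l > 0"
      using assms(2) by simp
    obtain b :: "nat \<Rightarrow> nat \<Rightarrow> int"
      where b: "\<And>r. r \<in> {..<card T} \<Longrightarrow> [(\<Sum>j<m. b r j) = 0] (mod int n)"
          "\<And>j. j < m \<Longrightarrow> bij_betw (\<lambda>r. b r j) {..<card T} T"
      using extend_rows[OF assms(3) neg \<open>l > 0\<close> sum bij, of q] unfolding q by blast
    have "m \<ge> 3"
      using assms(2) m(1) by simp
    then show "\<exists>P. cycle_factorization m (cycle_blowup m n T) P"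
      using cycle_factorization_of_rows[OF assms(1) _ assms(3) b] by blast
  qed
qed

end
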